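(* Let $X$ and $Y$ be non-negative random variables with absolutely continuous distributions, with reversed hazard rate functions $\tau_X$ and $\tau_Y$. Assume that $X\ge_{lr}Y$ and that $\tau_Y(t)/\tau_X(t)$ is decreasing in $t\ge0$. If $X$ is IPEX, then $Y$ is also IPEX.
   Context: For a non-negative random variable $X$ with density $f_X$ and distribution function $F_X$, the reversed hazard rate is $\tau_X(t)=f_X(t)/F_X(t)$, and the past extropy at $t$ is $$\widetilde{\mathfrak{J}}(X;t)=-\frac12\int_0^t\left[\frac{f_X(u)}{F_X(t)}\right]^2du,$$ considered for those $t$ with $F_X(t)>0$. $X$ is IPEX (increasing past extropy) if $\widetilde{\mathfrak{J}}(X;t)$ is increasing in $t>0$. The notation is analogous for $Y$. $X\ge_{lr}Y$ (likelihood ratio order) means that $f_X(x)/f_Y(x)$ is increasing in $x$ over the union of the supports of $X$ and $Y$. "Increasing" and "decreasing" are in the non-strict sense.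
   Formalization: Assumes in addition that F_X(t)>0 whenever F_Y(t)>0, so that τ_Y(t)/τ_X(t) is defined wherever τ_Y(t) is; if such points are ignored the claim fails, e.g. for X uniform on (1,2] and a non-IPEX Y on [0,1]. *)

theory Defs
  imports "HOL-Probability.Probability"
begin

(* In the definitions below, f is a fixed real-valued version of the density of X. *)

definition distr_fun :: "'a measure \<Rightarrow> ('a \<Rightarrow> real) \<Rightarrow> real \<Rightarrow> real" where
  "distr_fun M X t = cdf (distr M borel X) t"

definition nonneg_rv_density :: "'a measure \<Rightarrow> ('a \<Rightarrow> real) \<Rightarrow> (real \<Rightarrow> real) \<Rightarrow> bool" where
  "nonneg_rv_density M X f \<longleftrightarrow>
     prob_space M \<and> (AE \<omega> in M. 0 \<le> X \<omega>) \<and>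
     (\<forall>x. 0 \<le> f x) \<and> distributed M lborel X (\<lambda>x. ennreal (f x))"

(* Meaningful only where the distribution function is positive; elsewhere the value is the
   junk value 0, and every use below is restricted accordingly. *)
definition rev_hazard :: "'a measure \<Rightarrow> ('a \<Rightarrow> real) \<Rightarrow> (real \<Rightarrow> real) \<Rightarrow> real \<Rightarrow> real" where
  "rev_hazard M X f t = f t / distr_fun M X t"

(* Extended real valued: f need not be square integrable, and the past extropy is then
   -\<infinity> (a Bochner integral would silently return 0). *)
definition past_extropy :: "'a measure \<Rightarrow> ('a \<Rightarrow> real) \<Rightarrow> (real \<Rightarrow> real) \<Rightarrow> real \<Rightarrow> ereal" where
  "past_extropy M X f t =
     - (ereal (1/2) *
        enn2ereal (\<integral>\<^sup>+ u \<in> {0..t}. ennreal ((f u / distr_fun M X t)\<^sup>2) \<partial>lborel))"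

definition IPEX :: "'a measure \<Rightarrow> ('a \<Rightarrow> real) \<Rightarrow> (real \<Rightarrow> real) \<Rightarrow> bool" where
  "IPEX M X f \<longleftrightarrow> mono_on {t. 0 < t \<and> 0 < distr_fun M X t} (past_extropy M X f)"

(* X \<ge>_lr Y for densities f of X and g of Y. The quotient is taken in [0, \<infinity>], where
   a / 0 = \<infinity> for a > 0, the usual convention for this order; the supports are the sets
   where the densities are positive, so that 0 / 0 does not occur. *)
definition lr_ge :: "(real \<Rightarrow> real) \<Rightarrow> (real \<Rightarrow> real) \<Rightarrow> bool" where
  "lr_ge f g \<longleftrightarrow> mono_on ({x. 0 < f x} \<union> {x. 0 < g x}) (\<lambda>x. ennreal (f x) / ennreal (g x))"

(* The points t \<ge> 0 at which both reversed hazard rates are defined and their quotient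
   (in [0, \<infinity>], with a / 0 = \<infinity> for a > 0) is not of the form 0 / 0. *)
definition rev_hazard_ratio_dom ::
  "'a measure \<Rightarrow> ('a \<Rightarrow> real) \<Rightarrow> (real \<Rightarrow> real) \<Rightarrow>
   'b measure \<Rightarrow> ('b \<Rightarrow> real) \<Rightarrow> (real \<Rightarrow> real) \<Rightarrow> real set" where
  "rev_hazard_ratio_dom M X f N Y g =
     {t. 0 \<le> t \<and> 0 < distr_fun M X t \<and> 0 < distr_fun N Y t \<and>
         \<not> (rev_hazard M X f t = 0 \<and> rev_hazard N Y g t = 0)}"

end

theory Submission
  imports Defs
begin

text \<open>
  Write \<open>f, F\<close> and \<open>g, G\<close> for density and distribution function of \<open>X\<close> and \<open>Y\<close>, put
  \<open>h = g / f\<close> and \<open>r = \<tau>_Y / \<tau>_X = h F / G\<close>, and let \<open>\<Phi>\<close> and \<open>\<Gamma>\<close> be the integrals of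
  \<open>f\<^sup>2\<close> and \<open>g\<^sup>2\<close> over \<open>(-\<infinity>, t]\<close>. Past extropy is \<open>- \<Phi> / (2 F\<^sup>2)\<close>, so the hypothesis says that
  \<open>\<Phi> / F\<^sup>2\<close> decreases and the claim is that \<open>\<Gamma> / G\<^sup>2\<close> does; both \<open>h\<close> and \<open>r\<close> decrease.

  Fix \<open>s \<le> t\<close> and put \<open>A = \<Phi> s / (F s)\<^sup>2\<close>. Since \<open>(F u)\<^sup>2\<close> is the integral of \<open>2 F f\<close> up to
  \<open>u\<close> (\<open>nn_integral_primitive_square\<close>), the monotonicity of \<open>\<Phi> / F\<^sup>2\<close> compares, at \<open>s\<close>, the measure with
  density \<open>f\<^sup>2\<close> and the measure with density \<open>2 A F f\<close>: on initial pieces \<open>(-\<infinity>, u]\<close> with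
  \<open>u \<le> s\<close> the first is larger, on the pieces \<open>(s, u]\<close> it is smaller. A decreasing weight such as
  \<open>h\<^sup>2\<close> preserves comparisons on initial pieces
  (\<open>nn_integral_antimono_weight_mono\<close>, a form of stochastic dominance). As \<open>h\<^sup>2 f\<^sup>2 = g\<^sup>2\<close> and
  \<open>h\<^sup>2 \<cdot> 2 F f = r \<cdot> 2 G g\<close>, and as a number \<open>\<rho>\<close> separates the values of \<open>r\<close> before \<open>s\<close> from
  those after \<open>s\<close>, this gives
  \<open>\<Gamma> s \<ge> A \<rho> (G s)\<^sup>2\<close> and \<open>\<Gamma> t - \<Gamma> s \<le> A \<rho> ((G t)\<^sup>2 - (G s)\<^sup>2)\<close>.
  Eliminating \<open>A \<rho>\<close> yields \<open>\<Gamma> t (G s)\<^sup>2 \<le> \<Gamma> s (G t)\<^sup>2\<close>, which is the claim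
  (\<open>normalised_square_integral_antimono\<close>).

  No derivative of the extropy is taken, and all quantities live in \<open>[0, \<infinity>]\<close>, so that densities that
  are not square integrable are covered by the same computation.
\<close>

section \<open>Integrals of a density against its primitive\<close>

lemma borel_measurable_nn_integral_atMost [measurable]:
  fixes f :: "real \<Rightarrow> ennreal"
  assumes [measurable]: "f \<in> borel_measurable borel"
  shows "(\<lambda>t. \<integral>\<^sup>+v\<in>{..t}. f v \<partial>lborel) \<in> borel_measurable borel"
proof -
  have "(\<lambda>t. \<integral>\<^sup>+v. f v * (if v \<le> t then 1 else 0) \<partial>lborel) \<in> borel_measurable borel"
    by measurable
  then show ?thesis
    by (simp add: indicator_def)
qed

text \<open>
  The rule \<open>d(F\<^sup>2) = 2 F dF\<close> for a primitive that need not be differentiable anywhere: the square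
  \<open>(-\<infinity>, t]\<^sup>2\<close> is cut along the diagonal, a null set, and Tonelli identifies the integrals of
  \<open>f u f v\<close> over the two halves.
\<close>

lemma nn_integral_primitive_square:
  fixes f :: "real \<Rightarrow> ennreal"
  assumes [measurable]: "f \<in> borel_measurable borel"
  shows "(\<integral>\<^sup>+u\<in>{..t}. 2 * (\<integral>\<^sup>+v\<in>{..u}. f v \<partial>lborel) * f u \<partial>lborel)
       = (\<integral>\<^sup>+v\<in>{..t}. f v \<partial>lborel)\<^sup>2"
proof -
  define L where "L = (\<integral>\<^sup>+u\<in>{..t}. (\<integral>\<^sup>+v\<in>{..u}. f v \<partial>lborel) * f u \<partial>lborel)"
  define T where "T u v = f v * (f u * (if v \<le> u \<and> u \<le> t then 1 else 0))" for u v
  have T_meas [measurable]: "case_prod T \<in> borel_measurable (lborel \<Otimes>\<^sub>M lborel)"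
    unfolding T_def by measurable
  have L1: "L = (\<integral>\<^sup>+u. \<integral>\<^sup>+v. T u v \<partial>lborel \<partial>lborel)"
    unfolding L_def T_def
    by (subst nn_integral_multc[symmetric], measurable, (subst nn_integral_multc[symmetric], measurable)?)
      (auto intro!: nn_integral_cong simp: indicator_def mult_ac)
  have L2: "L = (\<integral>\<^sup>+u. \<integral>\<^sup>+v. T v u \<partial>lborel \<partial>lborel)"
    unfolding L1 by (rule lborel_pair.Fubini'[symmetric]) measurable
  have "2 * L = (\<integral>\<^sup>+u. \<integral>\<^sup>+v. T u v + T v u \<partial>lborel \<partial>lborel)"
    unfolding mult_2
    by (subst (1) L1, subst L2) (simp add: nn_integral_add)
  also have "\<dots> = (\<integral>\<^sup>+u. f u * indicator {..t} u * (\<integral>\<^sup>+v\<in>{..t}. f v \<partial>lborel) \<partial>lborel)"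
  proof (intro nn_integral_cong)
    fix u :: real
    have "(\<integral>\<^sup>+v. T u v + T v u \<partial>lborel)
        = (\<integral>\<^sup>+v. (f u * indicator {..t} u) * (f v * indicator {..t} v) \<partial>lborel)"
      using AE_lborel_singleton[of u]
      by (intro nn_integral_cong_AE) (auto simp: T_def indicator_def mult_ac)
    then show "(\<integral>\<^sup>+v. T u v + T v u \<partial>lborel)
        = f u * indicator {..t} u * (\<integral>\<^sup>+v\<in>{..t}. f v \<partial>lborel)"
      by (simp add: nn_integral_cmult)
  qed
  also have "\<dots> = (\<integral>\<^sup>+v\<in>{..t}. f v \<partial>lborel)\<^sup>2"
    by (simp add: nn_integral_multc power2_eq_square)
  finally have "2 * L = (\<integral>\<^sup>+v\<in>{..t}. f v \<partial>lborel)\<^sup>2" .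
  moreover have "2 * L = (\<integral>\<^sup>+u\<in>{..t}. 2 * (\<integral>\<^sup>+v\<in>{..u}. f v \<partial>lborel) * f u \<partial>lborel)"
    unfolding L_def by (subst nn_integral_cmult[symmetric]) (auto simp: mult_ac)
  ultimately show ?thesis by simp
qed

lemma nn_integral_atMost_split:
  fixes k :: "real \<Rightarrow> ennreal"
  assumes [measurable]: "k \<in> borel_measurable borel" and "s \<le> t"
  shows "(\<integral>\<^sup>+u\<in>{..t}. k u \<partial>lborel)
       = (\<integral>\<^sup>+u\<in>{..s}. k u \<partial>lborel) + (\<integral>\<^sup>+u\<in>{s<..t}. k u \<partial>lborel)"
  using \<open>s \<le> t\<close>
  by (subst nn_integral_add[symmetric]) (auto intro!: nn_integral_cong simp: indicator_def)

lemma nn_integral_restrict_atMost: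
  fixes k :: "real \<Rightarrow> ennreal"
  shows "(\<integral>\<^sup>+u\<in>{..a}. k u * indicator {..s} u \<partial>lborel) = (\<integral>\<^sup>+u\<in>{..min a s}. k u \<partial>lborel)"
  by (auto intro!: nn_integral_cong simp: indicator_def)

lemma nn_integral_restrict_greaterThanAtMost:
  fixes k :: "real \<Rightarrow> ennreal"
  shows "(\<integral>\<^sup>+u\<in>{..a}. k u * indicator {s<..t} u \<partial>lborel) = (\<integral>\<^sup>+u\<in>{s<..min a t}. k u \<partial>lborel)"
  by (auto intro!: nn_integral_cong simp: indicator_def)

lemma primitive_mono:
  fixes F :: "real \<Rightarrow> real" and k :: "real \<Rightarrow> ennreal"
  assumes F: "\<And>t. (\<integral>\<^sup>+u\<in>{..t}. k u \<partial>lborel) = ennreal (F t)"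
    and "u \<le> v" and "0 \<le> F v"
  shows "F u \<le> F v"
proof -
  have "ennreal (F u) \<le> ennreal (F v)"
    unfolding F[symmetric] using \<open>u \<le> v\<close> by (intro nn_integral_mono) (auto simp: indicator_def)
  then show ?thesis using \<open>0 \<le> F v\<close> by simp
qed

section \<open>Decreasing weights and comparison on half-lines\<close>

lemma down_closed_real_cases:
  fixes J :: "real set"
  assumes down: "\<And>u v. v \<in> J \<Longrightarrow> u \<le> v \<Longrightarrow> u \<in> J"
  shows "J = {} \<or> J = UNIV \<or> (\<exists>a. J = {..a}) \<or> (\<exists>a. J = {..<a})"
proof (cases "J = {} \<or> \<not> bdd_above J")
  case True
  have "J = UNIV" if "\<not> bdd_above J"
  proof -
    have "x \<in> J" for x
    proof -
      obtain v where "v \<in> J" "x \<le> v"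
        using \<open>\<not> bdd_above J\<close> unfolding bdd_above_def by (meson linear)
      then show ?thesis by (rule down)
    qed
    then show ?thesis by auto
  qed
  then show ?thesis using True by argo
next
  case False
  have below: "x \<in> J" if "x < Sup J" for x
  proof -
    obtain v where "v \<in> J" "x < v"
      using False less_cSupD[of J x] \<open>x < Sup J\<close> by blast
    then show ?thesis using down by (simp add: less_imp_le)
  qed
  have above: "x \<le> Sup J" if "x \<in> J" for x
    using that False by (simp add: cSup_upper)
  show ?thesis
  proof (cases "Sup J \<in> J")
    case True
    then have "J = {..Sup J}" using above down by auto
    then show ?thesis by metis
  next
    case sup_notin: False
    have "J = {..<Sup J}"
      using above below sup_notin by (auto simp: less_le)
    then show ?thesis by metis
  qed
qed

text \<open>
  Superlevel sets of a decreasing function are initial pieces of the line, possibly open or unbounded,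
  while the comparison is given on closed half-lines. An end point is a null set, and the whole line
  is reached by monotone convergence.
\<close>

lemma nn_integral_down_closed_mono:
  fixes p q :: "real \<Rightarrow> ennreal"
  assumes [measurable]: "p \<in> borel_measurable borel" "q \<in> borel_measurable borel"
    and le: "\<And>a. (\<integral>\<^sup>+u\<in>{..a}. p u \<partial>lborel) \<le> (\<integral>\<^sup>+u\<in>{..a}. q u \<partial>lborel)"
    and J: "\<And>u v. v \<in> J \<Longrightarrow> u \<le> v \<Longrightarrow> u \<in> J"
  shows "(\<integral>\<^sup>+u\<in>J. p u \<partial>lborel) \<le> (\<integral>\<^sup>+u\<in>J. q u \<partial>lborel)"
proof -
  have "J = {} \<or> J = UNIV \<or> (\<exists>a. J = {..a}) \<or> (\<exists>a. J = {..<a})"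
    by (rule down_closed_real_cases) (rule J)
  then consider "J = {}" | "J = UNIV" | a where "J = {..a}" | a where "J = {..<a}"
    by blast
  then show ?thesis
  proof cases
    case 1 then show ?thesis by simp
  next
    case 2
    have sup: "(\<integral>\<^sup>+u. k u \<partial>lborel) = (SUP n. \<integral>\<^sup>+u\<in>{..real n}. k u \<partial>lborel)"
      if [measurable]: "k \<in> borel_measurable borel" for k :: "real \<Rightarrow> ennreal"
    proof -
      have "(SUP n. k u * indicator {..real n} u) = k u" for u
      proof (rule antisym)
        obtain n where "u \<le> real n" using real_arch_simple by blast
        then show "k u \<le> (SUP n. k u * indicator {..real n} u)"
          by (intro SUP_upper2[of n]) auto
      qed (auto intro!: SUP_least simp: indicator_def)
      moreover have "incseq (\<lambda>n u. k u * indicator {..real n} u)"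
        by (auto simp: incseq_def le_fun_def indicator_def)
      ultimately show ?thesis
        using nn_integral_monotone_convergence_SUP[of "\<lambda>n u. k u * indicator {..real n} u" lborel]
        by simp
    qed
    have "(\<integral>\<^sup>+u. p u \<partial>lborel) \<le> (\<integral>\<^sup>+u. q u \<partial>lborel)"
      unfolding sup[OF assms(1)] sup[OF assms(2)] by (intro SUP_mono' le)
    then show ?thesis using 2 by simp
  next
    case (3 a) then show ?thesis using le by simp
  next
    case (4 a)
    have "(\<integral>\<^sup>+u\<in>{..<a}. k u \<partial>lborel) = (\<integral>\<^sup>+u\<in>{..a}. k u \<partial>lborel)" for k :: "real \<Rightarrow> ennreal"
      using AE_lborel_singleton[of a] by (intro nn_integral_cong_AE) (auto simp: indicator_def)
    then show ?thesis using le 4 by simp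
  qed
qed

text \<open>
  Tonelli for the region under the graph of \<open>w\<close>, as \<open>w u\<close> is the length of
  \<open>{y. 0 \<le> y \<and> y < w u}\<close>.
\<close>

lemma layer_cake:
  fixes p w :: "real \<Rightarrow> ennreal"
  assumes [measurable]: "p \<in> borel_measurable borel" "w \<in> borel_measurable borel"
  shows "(\<integral>\<^sup>+u. w u * p u \<partial>lborel)
       = (\<integral>\<^sup>+y\<in>{0..}. (\<integral>\<^sup>+u\<in>{u. ennreal y < w u}. p u \<partial>lborel) \<partial>lborel)"
proof -
  have level: "emeasure lborel {y. 0 \<le> y \<and> ennreal y < c} = c" for c
  proof (cases c)
    case (real x)
    then have "{y. 0 \<le> y \<and> ennreal y < c} = {0..<x}"
      by (auto simp: ennreal_less_iff)
    then show ?thesis using real by simp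
  next
    case top
    then have "{y. 0 \<le> y \<and> ennreal y < c} = {0..}" by auto
    moreover have "emeasure lborel {0::real..} = top"
    proof -
      have "(SUP n. of_nat n) \<le> emeasure lborel {0::real..}"
      proof (rule SUP_least)
        fix n :: nat
        have "of_nat n = emeasure lborel {0..real n}" by (simp add: ennreal_of_nat_eq_real_of_nat)
        also have "\<dots> \<le> emeasure lborel {0::real..}" by (intro emeasure_mono) auto
        finally show "of_nat n \<le> emeasure lborel {0::real..}" .
      qed
      then show ?thesis by (simp add: ennreal_SUP_of_nat_eq_top top_unique)
    qed
    ultimately show ?thesis using top by simp
  qed
  define T where "T u y = p u * (if 0 \<le> y \<and> ennreal y < w u then 1 else 0)" for u y
  have [measurable]: "case_prod T \<in> borel_measurable (lborel \<Otimes>\<^sub>M lborel)"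
    unfolding T_def by measurable
  have "w u * p u = (\<integral>\<^sup>+y. T u y \<partial>lborel)" for u
  proof -
    have "(\<integral>\<^sup>+y. T u y \<partial>lborel) = (\<integral>\<^sup>+y. p u * indicator {y. 0 \<le> y \<and> ennreal y < w u} y \<partial>lborel)"
      by (intro nn_integral_cong) (auto simp: T_def)
    also have "\<dots> = p u * w u"
      by (subst nn_integral_cmult_indicator) (auto simp: level)
    finally show ?thesis by (simp add: mult.commute)
  qed
  then have "(\<integral>\<^sup>+u. w u * p u \<partial>lborel) = (\<integral>\<^sup>+u. \<integral>\<^sup>+y. T u y \<partial>lborel \<partial>lborel)"
    by simp
  also have "\<dots> = (\<integral>\<^sup>+y. \<integral>\<^sup>+u. T u y \<partial>lborel \<partial>lborel)"
    by (rule lborel_pair.Fubini'[symmetric]) measurable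
  also have "\<dots> = (\<integral>\<^sup>+y\<in>{0..}. (\<integral>\<^sup>+u\<in>{u. ennreal y < w u}. p u \<partial>lborel) \<partial>lborel)"
    by (intro nn_integral_cong) (auto simp: T_def indicator_def intro!: nn_integral_cong)
  finally show ?thesis .
qed

text \<open>
  By \<open>layer_cake\<close> it suffices to compare the integrals of \<open>p\<close> and \<open>q\<close> over the superlevel sets of
  \<open>w\<close>, which are initial pieces of the line as \<open>w\<close> decreases. Monotonicity is required only
  from points where \<open>p\<close> or \<open>q\<close> is non-zero: a quotient of
  densities is set to \<open>0\<close> at the zeros of its denominator and may be positive further to the right.
\<close>

lemma nn_integral_antimono_weight_mono:
  fixes p q w :: "real \<Rightarrow> ennreal"
  assumes [measurable]: "p \<in> borel_measurable borel" "q \<in> borel_measurable borel"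
      "w \<in> borel_measurable borel"
    and le: "\<And>a. (\<integral>\<^sup>+u\<in>{..a}. p u \<partial>lborel) \<le> (\<integral>\<^sup>+u\<in>{..a}. q u \<partial>lborel)"
    and w: "\<And>u v. u \<le> v \<Longrightarrow> p u \<noteq> 0 \<or> q u \<noteq> 0 \<Longrightarrow> w v \<le> w u"
  shows "(\<integral>\<^sup>+u. w u * p u \<partial>lborel) \<le> (\<integral>\<^sup>+u. w u * q u \<partial>lborel)"
  unfolding layer_cake[OF assms(1,3)] layer_cake[OF assms(2,3)]
proof (rule nn_integral_mono, rule mult_right_mono)
  fix y :: real
  \<comment> \<open>The superlevel set itself may have gaps where both densities vanish; filling them changes
    neither integral.\<close>
  define J where "J = {u. \<exists>v\<ge>u. ennreal y < w v}"
  have eq: "(\<integral>\<^sup>+u\<in>{u. ennreal y < w u}. k u \<partial>lborel) = (\<integral>\<^sup>+u\<in>J. k u \<partial>lborel)"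
    if "k = p \<or> k = q" for k
  proof (intro nn_integral_cong)
    fix u
    have "k u = 0 \<or> (ennreal y < w u \<longleftrightarrow> u \<in> J)"
      using that w[of u] unfolding J_def by (auto intro: less_le_trans)
    then show "k u * indicator {u. ennreal y < w u} u = k u * indicator J u"
      by (auto simp: indicator_def)
  qed
  have "(\<integral>\<^sup>+u\<in>J. p u \<partial>lborel) \<le> (\<integral>\<^sup>+u\<in>J. q u \<partial>lborel)"
    by (rule nn_integral_down_closed_mono) (use le in \<open>auto simp: J_def intro: order_trans\<close>)
  then show "(\<integral>\<^sup>+u\<in>{u. ennreal y < w u}. p u \<partial>lborel)
      \<le> (\<integral>\<^sup>+u\<in>{u. ennreal y < w u}. q u \<partial>lborel)"
    by (simp add: eq)
qed simp

section \<open>Transfer of the monotonicity from f to g\<close>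

text \<open>
  The core of the argument, with the two monotone quotients \<open>h = g / f\<close> and \<open>r = h F / G\<close>
  and the monotonicity of \<open>\<Phi> / F\<^sup>2\<close> given in cross-multiplied form, so that zeros and infinite
  values need no separate convention.
\<close>

lemma normalised_square_integral_antimono:
  fixes f g F G :: "real \<Rightarrow> real"
  assumes [measurable]: "f \<in> borel_measurable borel" "g \<in> borel_measurable borel"
    and f0: "\<And>u. 0 \<le> f u" and g0: "\<And>u. 0 \<le> g u"
    and F0: "\<And>u. 0 \<le> F u" and G0: "\<And>u. 0 \<le> G u"
    and F: "\<And>t. (\<integral>\<^sup>+u\<in>{..t}. f u \<partial>lborel) = ennreal (F t)"
    and G: "\<And>t. (\<integral>\<^sup>+u\<in>{..t}. g u \<partial>lborel) = ennreal (G t)"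
    and GF: "\<And>t. 0 < G t \<Longrightarrow> 0 < F t"
    and lr: "\<And>u v. u \<le> v \<Longrightarrow> f u * g v \<le> f v * g u"
    and ratio: "\<And>u v. u \<le> v \<Longrightarrow> 0 < G u \<Longrightarrow> (g v * F v) * (f u * G u) \<le> (g u * F u) * (f v * G v)"
    and f_mono: "\<And>u v. u \<le> v \<Longrightarrow> 0 < F u \<Longrightarrow>
      (\<integral>\<^sup>+x\<in>{..v}. ennreal (f x ^ 2) \<partial>lborel) * ennreal (F u ^ 2)
      \<le> (\<integral>\<^sup>+x\<in>{..u}. ennreal (f x ^ 2) \<partial>lborel) * ennreal (F v ^ 2)"
    and st: "s \<le> t" and Gs: "0 < G s"
  shows "(\<integral>\<^sup>+x\<in>{..t}. ennreal (g x ^ 2) \<partial>lborel) * ennreal (G s ^ 2)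
      \<le> (\<integral>\<^sup>+x\<in>{..s}. ennreal (g x ^ 2) \<partial>lborel) * ennreal (G t ^ 2)"
proof -
  define \<Phi> where "\<Phi> t = (\<integral>\<^sup>+x\<in>{..t}. ennreal (f x ^ 2) \<partial>lborel)" for t
  \<comment> \<open>The weight \<open>h\<^sup>2\<close>.\<close>
  define w where "w u = ennreal ((g u / f u) ^ 2)" for u
  \<comment> \<open>The densities of \<open>d(F\<^sup>2)\<close> and \<open>d(G\<^sup>2)\<close>.\<close>
  define pF where "pF u = ennreal (2 * F u * f u)" for u
  define pG where "pG u = ennreal (2 * G u * g u)" for u

  have F_mono: "F u \<le> F v" and G_mono: "G u \<le> G v" if "u \<le> v" for u v
    using primitive_mono[OF F] primitive_mono[OF G] F0 G0 that by auto
  have [measurable]: "F \<in> borel_measurable borel" "G \<in> borel_measurable borel"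
    using F_mono G_mono by (auto intro!: borel_measurable_mono simp: mono_def)
  have [measurable]: "w \<in> borel_measurable borel" "pF \<in> borel_measurable borel"
      "pG \<in> borel_measurable borel"
    unfolding w_def pF_def pG_def by measurable
  have Fs: "0 < F s" using GF Gs by blast

  \<comment> \<open>If \<open>f\<close> vanishes at \<open>u\<close> but \<open>g\<close> does not, the decreasing quotient \<open>h\<close> is infinite
    up to \<open>u\<close>, so \<open>f\<close> vanishes there. Hence \<open>g = h f\<close> wherever \<open>F > 0\<close>.\<close>
  have g_zero: "g u = 0" if "0 < F u" "f u = 0" for u
  proof (rule ccontr)
    assume "g u \<noteq> 0"
    then have "0 < g u" using g0[of u] by simp
    have "f v = 0" if "v \<le> u" for v
      using lr[OF that] \<open>f u = 0\<close> \<open>0 < g u\<close> f0[of v] by (simp add: mult_le_0_iff)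
    then have "(\<integral>\<^sup>+v\<in>{..u}. f v \<partial>lborel) = 0"
      by (intro nn_integral_zero') (auto simp: indicator_def)
    with F[of u] that(1) show False by simp
  qed

  have pF_int: "(\<integral>\<^sup>+u\<in>{..a}. pF u \<partial>lborel) = ennreal (F a ^ 2)" for a
    using nn_integral_primitive_square[of "\<lambda>x. ennreal (f x)" a] F0 f0
    by (simp add: F pF_def ennreal_mult ennreal_power)
  have pG_int: "(\<integral>\<^sup>+u\<in>{..a}. pG u \<partial>lborel) = ennreal (G a ^ 2)" for a
    using nn_integral_primitive_square[of "\<lambda>x. ennreal (g x)" a] G0 g0
    by (simp add: G pG_def ennreal_mult ennreal_power)

  define A where "A = \<Phi> s / ennreal (F s ^ 2)"
  have AFs: "A * ennreal (F s ^ 2) = \<Phi> s"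
    unfolding A_def using Fs by (simp add: ennreal_divide_times ennreal_times_divide mult_divide_eq_ennreal)
  have A_le: "A * ennreal (F u ^ 2) \<le> \<Phi> u" if "u \<le> s" for u
  proof (cases "F u = 0")
    case False
    then have "0 < F u" using F0[of u] by simp
    then have "\<Phi> s * ennreal (F u ^ 2) \<le> \<Phi> u * ennreal (F s ^ 2)"
      using f_mono[OF that] by (simp add: \<Phi>_def)
    then have "\<Phi> s * ennreal (F u ^ 2) / ennreal (F s ^ 2) \<le> \<Phi> u * ennreal (F s ^ 2) / ennreal (F s ^ 2)"
      by (rule divide_right_mono_ennreal)
    also have "\<dots> = \<Phi> u" using Fs by (simp add: ennreal_mult_divide_eq)
    also have "\<Phi> s * ennreal (F u ^ 2) / ennreal (F s ^ 2) = A * ennreal (F u ^ 2)"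
      unfolding A_def by (simp add: ennreal_divide_times mult.commute ennreal_times_divide)
    finally show ?thesis .
  qed simp
  have A_ge: "(\<integral>\<^sup>+x\<in>{s<..u}. ennreal (f x ^ 2) \<partial>lborel) \<le> A * (\<integral>\<^sup>+x\<in>{s<..u}. pF x \<partial>lborel)"
    (is "?I \<le> A * ?D") if "s \<le> u" for u
  proof -
    have F2: "ennreal (F u ^ 2) = ennreal (F s ^ 2) + ?D"
      using nn_integral_atMost_split[of pF s u] that by (simp add: pF_int)
    have P2: "\<Phi> u = \<Phi> s + ?I"
      unfolding \<Phi>_def using that by (intro nn_integral_atMost_split) auto
    \<comment> \<open>For finite \<open>A\<close> the term \<open>\<Phi> s\<close> can be cancelled. For infinite \<open>A\<close> the only danger is
      \<open>\<infinity> \<cdot> 0\<close> on the right, but then \<open>f = 0\<close> almost everywhere between \<open>s\<close> and \<open>u\<close>.\<close>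
    show ?thesis
    proof (cases "A = top")
      case True
      show ?thesis
      proof (cases "?D = 0")
        case True
        then have "AE x in lborel. pF x * indicator {s<..u} x = 0"
          by (subst (asm) nn_integral_0_iff_AE) auto
        then have "AE x in lborel. ennreal (f x ^ 2) * indicator {s<..u} x = 0"
        proof eventually_elim
          case (elim x)
          have "x \<in> {s<..u} \<Longrightarrow> 0 < F x" using Fs F_mono[of s x] by simp
          then show ?case using elim f0[of x]
            by (auto simp: pF_def indicator_def mult_le_0_iff ennreal_eq_0_iff split: if_splits)
        qed
        then have "?I = 0" by (subst nn_integral_0_iff_AE) auto
        then show ?thesis by simp
      next
        case False
        then show ?thesis using \<open>A = top\<close> by (simp add: ennreal_top_mult)
      qed
    next
      case False
      then have "\<Phi> s \<noteq> top" using AFs by (auto simp: ennreal_mult_eq_top_iff)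
      have "\<Phi> u * ennreal (F s ^ 2) \<le> A * ennreal (F s ^ 2) * ennreal (F u ^ 2)"
        using f_mono[OF that Fs] AFs by (simp add: \<Phi>_def)
      then have "\<Phi> u * ennreal (F s ^ 2) / ennreal (F s ^ 2)
          \<le> (A * ennreal (F u ^ 2)) * ennreal (F s ^ 2) / ennreal (F s ^ 2)"
        by (intro divide_right_mono_ennreal) (simp add: mult_ac)
      then have "\<Phi> u \<le> A * ennreal (F u ^ 2)"
        using Fs by (simp add: ennreal_mult_divide_eq)
      then have "\<Phi> s + ?I \<le> \<Phi> s + A * ?D"
        by (simp add: F2 P2 distrib_left AFs)
      then show ?thesis using \<open>\<Phi> s \<noteq> top\<close> by (simp add: ennreal_add_left_cancel_le)
    qed
  qed

  \<comment> \<open>\<open>R\<close> is the quotient \<open>r\<close> of reversed hazard rates. It may be undefined at \<open>s\<close>, so its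
    value there is replaced by the least bound \<open>\<rho>\<close> of the values from \<open>s\<close> on.\<close>
  define R where "R v = ennreal (g v * F v / (f v * G v))" for v
  define \<rho> where "\<rho> = (SUP v\<in>{v. s \<le> v \<and> 0 < f v}. R v)"
  have \<rho>_ge: "R v \<le> \<rho>" if "s \<le> v" "0 < f v" for v
    unfolding \<rho>_def using that by (intro SUP_upper) auto
  have \<rho>_le: "\<rho> \<le> R u" if "u \<le> s" "0 < f u" "0 < G u" for u
    unfolding \<rho>_def
  proof (rule SUP_least)
    fix v assume v: "v \<in> {v. s \<le> v \<and> 0 < f v}"
    then have "0 < G v" using Gs G_mono[of s v] by simp
    then show "R v \<le> R u"
      using v that ratio[of u v] unfolding R_def
      by (intro ennreal_leI) (simp add: divide_simps mult_ac)
  qed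
  have w_anti: "w v \<le> w u" if "u \<le> v" "0 < f u" for u v
  proof (cases "f v = 0")
    case False
    then have "0 < f v" using f0[of v] by simp
    then have "g v / f v \<le> g u / f u"
      using that lr[OF that(1)] by (simp add: divide_simps mult_ac)
    then show ?thesis unfolding w_def using f0[of v] g0[of v]
      by (intro ennreal_leI power_mono) auto
  qed (simp add: w_def)
  \<comment> \<open>The key identity \<open>h\<^sup>2 \<cdot> 2 F f = r \<cdot> 2 G g\<close>.\<close>
  have weight: "w u * pF u = pG u * R u" if "0 < f u" "0 < G u" for u
    using that F0[of u] g0[of u] unfolding w_def pF_def pG_def R_def
    by (subst (1 2) ennreal_mult[symmetric]) (auto simp: field_simps power2_eq_square)
  have wf: "w u * ennreal (f u ^ 2) = ennreal (g u ^ 2)" if "0 < f u" for u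
    using that g0[of u] unfolding w_def
    by (subst ennreal_mult[symmetric]) (auto simp: power_divide)

  have lower: "A * \<rho> * ennreal (G s ^ 2) \<le> (\<integral>\<^sup>+x\<in>{..s}. ennreal (g x ^ 2) \<partial>lborel)"
  proof -
    have "A * \<rho> * ennreal (G s ^ 2) = (\<integral>\<^sup>+u. A * \<rho> * (pG u * indicator {..s} u) \<partial>lborel)"
      by (subst nn_integral_cmult) (auto simp: pG_int)
    also have "\<dots> \<le> (\<integral>\<^sup>+u. w u * (A * pF u * indicator {..s} u) \<partial>lborel)"
    proof (intro nn_integral_mono)
      fix u
      have "\<rho> * pG u \<le> w u * pF u" if "u \<le> s"
      proof (cases "0 < f u \<and> 0 < G u")
        case True
        then have "\<rho> * pG u \<le> R u * pG u"
          using \<rho>_le that by (intro mult_right_mono) auto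
        then show ?thesis using weight True by (simp add: mult.commute)
      next
        case False
        then have "G u = 0 \<or> g u = 0"
          using g_zero[of u] GF[of u] f0[of u] G0[of u] by fastforce
        then have "pG u = 0" by (auto simp: pG_def)
        then show ?thesis by simp
      qed
      then have "u \<le> s \<Longrightarrow> A * (\<rho> * pG u) \<le> A * (w u * pF u)" by (intro mult_left_mono) auto
      then show "A * \<rho> * (pG u * indicator {..s} u) \<le> w u * (A * pF u * indicator {..s} u)"
        by (auto simp: indicator_def mult_ac)
    qed
    also have "\<dots> \<le> (\<integral>\<^sup>+u. w u * (ennreal (f u ^ 2) * indicator {..s} u) \<partial>lborel)"
    proof (rule nn_integral_antimono_weight_mono)
      fix a
      have "(\<integral>\<^sup>+u\<in>{..a}. A * pF u * indicator {..s} u \<partial>lborel) = A * (\<integral>\<^sup>+u\<in>{..min a s}. pF u \<partial>lborel)"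
        by (subst nn_integral_restrict_atMost, subst nn_integral_cmult[symmetric]) (auto simp: mult.assoc)
      also have "\<dots> \<le> \<Phi> (min a s)" unfolding pF_int by (rule A_le) simp
      also have "\<dots> = (\<integral>\<^sup>+u\<in>{..a}. ennreal (f u ^ 2) * indicator {..s} u \<partial>lborel)"
        by (simp add: \<Phi>_def nn_integral_restrict_atMost)
      finally show "(\<integral>\<^sup>+u\<in>{..a}. A * pF u * indicator {..s} u \<partial>lborel)
          \<le> (\<integral>\<^sup>+u\<in>{..a}. ennreal (f u ^ 2) * indicator {..s} u \<partial>lborel)" .
    next
      fix u v :: real
      assume "u \<le> v" and nz: "A * pF u * indicator {..s} u \<noteq> 0 \<or> ennreal (f u ^ 2) * indicator {..s} u \<noteq> 0"
      then have "f u \<noteq> 0" by (auto simp: pF_def)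
      with w_anti[OF \<open>u \<le> v\<close>] f0[of u] show "w v \<le> w u" by simp
    qed measurable
    also have "\<dots> \<le> (\<integral>\<^sup>+x\<in>{..s}. ennreal (g x ^ 2) \<partial>lborel)"
    proof (intro nn_integral_mono)
      fix u
      have "w u * ennreal (f u ^ 2) \<le> ennreal (g u ^ 2)"
        using wf[of u] f0[of u] by (cases "f u = 0") (auto simp: w_def)
      then show "w u * (ennreal (f u ^ 2) * indicator {..s} u) \<le> ennreal (g u ^ 2) * indicator {..s} u"
        by (auto simp: indicator_def)
    qed
    finally show ?thesis .
  qed

  have upper: "(\<integral>\<^sup>+x\<in>{s<..t}. ennreal (g x ^ 2) \<partial>lborel) \<le> A * \<rho> * (\<integral>\<^sup>+x\<in>{s<..t}. pG x \<partial>lborel)"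
  proof -
    have pos: "0 < F u" "0 < G u" if "u \<in> {s<..t}" for u
      using that Fs Gs F_mono[of s u] G_mono[of s u] by auto
    have "(\<integral>\<^sup>+x\<in>{s<..t}. ennreal (g x ^ 2) \<partial>lborel)
        = (\<integral>\<^sup>+u. w u * (ennreal (f u ^ 2) * indicator {s<..t} u) \<partial>lborel)"
    proof (intro nn_integral_cong)
      fix u
      have "u \<in> {s<..t} \<Longrightarrow> w u * ennreal (f u ^ 2) = ennreal (g u ^ 2)"
        using wf[of u] f0[of u] pos g_zero[of u] by (cases "f u = 0") (auto simp: w_def)
      then show "ennreal (g u ^ 2) * indicator {s<..t} u = w u * (ennreal (f u ^ 2) * indicator {s<..t} u)"
        by (auto simp: indicator_def)
    qed
    also have "\<dots> \<le> (\<integral>\<^sup>+u. w u * (A * pF u * indicator {s<..t} u) \<partial>lborel)"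
    proof (rule nn_integral_antimono_weight_mono)
      fix a
      show "(\<integral>\<^sup>+u\<in>{..a}. ennreal (f u ^ 2) * indicator {s<..t} u \<partial>lborel)
          \<le> (\<integral>\<^sup>+u\<in>{..a}. A * pF u * indicator {s<..t} u \<partial>lborel)"
      proof (cases "s \<le> min a t")
        case True
        have "(\<integral>\<^sup>+u\<in>{..a}. ennreal (f u ^ 2) * indicator {s<..t} u \<partial>lborel)
            \<le> A * (\<integral>\<^sup>+u\<in>{s<..min a t}. pF u \<partial>lborel)"
          unfolding nn_integral_restrict_greaterThanAtMost by (rule A_ge[OF True])
        also have "\<dots> = (\<integral>\<^sup>+u\<in>{..a}. A * pF u * indicator {s<..t} u \<partial>lborel)"
          by (subst nn_integral_restrict_greaterThanAtMost, subst nn_integral_cmult[symmetric])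
            (auto simp: mult.assoc)
        finally show ?thesis .
      next
        case False
        then have "indicator {s<..min a t} u = (0 :: ennreal)" for u by auto
        then show ?thesis by (simp only: nn_integral_restrict_greaterThanAtMost) simp
      qed
    next
      fix u v :: real
      assume "u \<le> v"
        and nz: "ennreal (f u ^ 2) * indicator {s<..t} u \<noteq> 0 \<or> A * pF u * indicator {s<..t} u \<noteq> 0"
      then have "f u \<noteq> 0" by (auto simp: pF_def)
      with w_anti[OF \<open>u \<le> v\<close>] f0[of u] show "w v \<le> w u" by simp
    qed measurable
    also have "\<dots> \<le> (\<integral>\<^sup>+u. A * \<rho> * (pG u * indicator {s<..t} u) \<partial>lborel)"
    proof (intro nn_integral_mono)
      fix u
      have "w u * pF u \<le> \<rho> * pG u" if "u \<in> {s<..t}"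
      proof (cases "f u = 0")
        case False
        then have "0 < f u" using f0[of u] by simp
        then have "R u * pG u \<le> \<rho> * pG u"
          using \<rho>_ge that by (intro mult_right_mono) auto
        then show ?thesis using weight[OF \<open>0 < f u\<close> pos(2)[OF that]] by (simp add: mult.commute)
      qed (simp add: w_def)
      then have "u \<in> {s<..t} \<Longrightarrow> A * (w u * pF u) \<le> A * (\<rho> * pG u)" by (intro mult_left_mono) auto
      then show "w u * (A * pF u * indicator {s<..t} u) \<le> A * \<rho> * (pG u * indicator {s<..t} u)"
        by (auto simp: indicator_def mult_ac)
    qed
    also have "\<dots> = A * \<rho> * (\<integral>\<^sup>+x\<in>{s<..t}. pG x \<partial>lborel)"
      by (rule nn_integral_cmult) measurable
    finally show ?thesis .
  qed

  let ?I = "\<integral>\<^sup>+x\<in>{..s}. ennreal (g x ^ 2) \<partial>lborel" and ?D = "\<integral>\<^sup>+x\<in>{s<..t}. pG x \<partial>lborel"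
  have G2: "ennreal (G t ^ 2) = ennreal (G s ^ 2) + ?D"
    using nn_integral_atMost_split[of pG s t] st by (simp add: pG_int)
  have "(\<integral>\<^sup>+x\<in>{..t}. ennreal (g x ^ 2) \<partial>lborel) * ennreal (G s ^ 2)
      = (?I + (\<integral>\<^sup>+x\<in>{s<..t}. ennreal (g x ^ 2) \<partial>lborel)) * ennreal (G s ^ 2)"
    using st by (subst nn_integral_atMost_split[of _ s t]) auto
  also have "\<dots> \<le> (?I + A * \<rho> * ?D) * ennreal (G s ^ 2)"
    by (intro mult_right_mono add_left_mono upper) simp
  also have "\<dots> = ?I * ennreal (G s ^ 2) + (A * \<rho> * ennreal (G s ^ 2)) * ?D"
    by (simp add: distrib_left distrib_right mult_ac)
  also have "\<dots> \<le> ?I * ennreal (G s ^ 2) + ?I * ?D"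
    by (intro add_left_mono mult_right_mono lower) simp
  also have "\<dots> = ?I * ennreal (G t ^ 2)"
    by (simp add: G2 distrib_left)
  finally show ?thesis .
qed

section \<open>Past extropy of non-negative random variables\<close>

lemma nonneg_rv_density_facts:
  assumes X: "nonneg_rv_density M X f"
  shows nonneg_rv_density_nonneg: "0 \<le> f x"
    and nonneg_rv_density_measurable: "f \<in> borel_measurable borel"
    and nonneg_rv_density_distr_fun:
      "(\<integral>\<^sup>+u\<in>{..t}. ennreal (f u) \<partial>lborel) = ennreal (distr_fun M X t)"
    and nonneg_rv_density_distr_fun_nonpos: "t \<le> 0 \<Longrightarrow> distr_fun M X t = 0"
    and nonneg_rv_density_AE_zero: "AE u in lborel. u \<le> 0 \<longrightarrow> f u = 0"
proof -
  interpret prob_space M using X by (simp add: nonneg_rv_density_def)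
  have D: "distributed M lborel X (\<lambda>x. ennreal (f x))" and f0: "\<And>x. 0 \<le> f x"
    and AE_X: "AE \<omega> in M. 0 \<le> X \<omega>"
    using X by (auto simp: nonneg_rv_density_def)
  have X_meas [measurable]: "X \<in> borel_measurable M"
    using distributed_measurable[OF D] by simp
  have "(\<lambda>x. enn2real (ennreal (f x))) \<in> borel_measurable borel"
    using distributed_borel_measurable[OF D] by measurable
  then show f_meas [measurable]: "f \<in> borel_measurable borel" using f0 by simp
  show "0 \<le> f x" by (rule f0)
  show F: "(\<integral>\<^sup>+u\<in>{..t}. ennreal (f u) \<partial>lborel) = ennreal (distr_fun M X t)" for t
  proof -
    have "(\<integral>\<^sup>+u\<in>{..t}. ennreal (f u) \<partial>lborel) = emeasure M (X -` {..t} \<inter> space M)"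
      using distributed_emeasure[OF D, of "{..t}"] by simp
    then show ?thesis
      by (simp add: distr_fun_def cdf_def measure_distr emeasure_eq_measure)
  qed
  have "(\<integral>\<^sup>+u\<in>{..<0}. ennreal (f u) \<partial>lborel) = emeasure M (X -` {..<0} \<inter> space M)"
    using distributed_emeasure[OF D, of "{..<0}"] by simp
  also have "X -` {..<0} \<inter> space M = {\<omega> \<in> space M. X \<omega> < 0}" by auto
  also have "emeasure M \<dots> = 0"
    using AE_X by (intro emeasure_eq_0_AE) (simp add: not_less)
  finally have "AE u in lborel. ennreal (f u) * indicator {..<0} u = 0"
    by (subst (asm) nn_integral_0_iff_AE) auto
  then show AE0: "AE u in lborel. u \<le> 0 \<longrightarrow> f u = 0"
    using AE_lborel_singleton[of 0]
  proof eventually_elim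
    case (elim u)
    then show ?case using f0[of u] by (auto simp: indicator_def ennreal_eq_0_iff split: if_splits)
  qed
  show "distr_fun M X t = 0" if "t \<le> 0"
  proof -
    have "(\<integral>\<^sup>+u\<in>{..t}. ennreal (f u) \<partial>lborel) = 0"
      using AE0 that by (subst nn_integral_0_iff_AE) (auto elim!: eventually_mono simp: indicator_def)
    then show ?thesis
      using F[of t] by (simp add: distr_fun_def cdf_def ennreal_eq_0_iff measure_le_0_iff)
  qed
qed

lemma distr_fun_nonneg: "0 \<le> distr_fun M X t"
  by (simp add: distr_fun_def cdf_def)

text \<open>
  The range \<open>[0, t]\<close> may be extended to \<open>(-\<infinity>, t]\<close> as the density vanishes almost everywhere on the
  negative half-line, and the constant \<open>F t\<close> comes out of the integral; the remaining inequality
  of quotients in \<open>[0, \<infinity>]\<close> is cross-multiplied.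
\<close>

lemma past_extropy_le_iff:
  assumes X: "nonneg_rv_density M X f"
    and pos: "0 < distr_fun M X s" "0 < distr_fun M X t"
  shows "past_extropy M X f s \<le> past_extropy M X f t \<longleftrightarrow>
      (\<integral>\<^sup>+u\<in>{..t}. ennreal (f u ^ 2) \<partial>lborel) * ennreal (distr_fun M X s ^ 2)
      \<le> (\<integral>\<^sup>+u\<in>{..s}. ennreal (f u ^ 2) \<partial>lborel) * ennreal (distr_fun M X t ^ 2)"
proof -
  note [measurable] = nonneg_rv_density_measurable[OF X]
  define \<Phi> where "\<Phi> t = (\<integral>\<^sup>+u\<in>{..t}. ennreal (f u ^ 2) \<partial>lborel)" for t
  have Q: "(\<integral>\<^sup>+u\<in>{0..t}. ennreal ((f u / distr_fun M X t)\<^sup>2) \<partial>lborel) = \<Phi> t / ennreal (distr_fun M X t ^ 2)"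
    if "0 < distr_fun M X t" for t
  proof -
    have "(\<integral>\<^sup>+u\<in>{0..t}. ennreal ((f u / distr_fun M X t)\<^sup>2) \<partial>lborel)
        = (\<integral>\<^sup>+u. ennreal (f u ^ 2) * indicator {..t} u / ennreal (distr_fun M X t ^ 2) \<partial>lborel)"
      using nonneg_rv_density_AE_zero[OF X] that
      by (intro nn_integral_cong_AE)
        (auto elim!: eventually_mono simp: indicator_def power_divide divide_ennreal)
    also have "\<dots> = \<Phi> t / ennreal (distr_fun M X t ^ 2)"
      unfolding \<Phi>_def by (rule nn_integral_divide) measurable
    finally show ?thesis .
  qed
  have cross: "a / ennreal x \<le> b / ennreal y \<longleftrightarrow> a * ennreal y \<le> b * ennreal x"
    if "0 < x" "0 < y" for a b :: ennreal and x y :: real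
    using that
    by (cases a; cases b)
      (auto simp: divide_ennreal ennreal_mult[symmetric] ennreal_top_divide ennreal_top_mult
        ennreal_mult_top top_unique field_simps)
  have half: "- (ereal (1/2) * a) \<le> - (ereal (1/2) * b) \<longleftrightarrow> b \<le> a" for a b
    by (cases a; cases b) auto
  show ?thesis
    unfolding past_extropy_def half Q[OF pos(1)] Q[OF pos(2)] \<Phi>_def[symmetric]
    using pos by (simp add: cross less_eq_ennreal.rep_eq[symmetric])
qed

text \<open>
  If both factors on the left are positive, then the quotient at \<open>v\<close> is finite, hence so is the one
  at \<open>u\<close>; this excludes \<open>g u = 0\<close>.
\<close>

lemma lr_ge_cross:
  assumes lr: "lr_ge f g" and f0: "\<And>x. 0 \<le> f x" and g0: "\<And>x. 0 \<le> g x" and uv: "u \<le> v"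
  shows "f u * g v \<le> f v * g u"
proof (cases "0 < f u \<and> 0 < g v")
  case True
  then have "ennreal (f u) / ennreal (g u) \<le> ennreal (f v) / ennreal (g v)"
    using lr uv by (auto simp: lr_ge_def mono_on_def)
  also have "\<dots> = ennreal (f v / g v)" using True f0 by (simp add: divide_ennreal)
  finally have le: "ennreal (f u) / ennreal (g u) \<le> ennreal (f v / g v)" .
  then have "g u \<noteq> 0" using True by (auto simp: ennreal_divide_zero top_unique)
  then have "0 < g u" using g0[of u] by simp
  then have "f u / g u \<le> f v / g v" using le True f0[of v] by (simp add: divide_ennreal)
  then show ?thesis using True \<open>0 < g u\<close> by (simp add: divide_simps mult_ac)
next
  case False
  then have "f u = 0 \<or> g v = 0" using f0[of u] g0[of v] by linarith
  then show ?thesis using f0[of v] g0[of u] by auto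
qed

theorem theorem4p1:
  fixes M :: "'a measure" and X :: "'a \<Rightarrow> real" and f_X :: "real \<Rightarrow> real"
    and N :: "'b measure" and Y :: "'b \<Rightarrow> real" and f_Y :: "real \<Rightarrow> real"
  assumes X: "nonneg_rv_density M X f_X"
    and Y: "nonneg_rv_density N Y f_Y"
    and lr: "lr_ge f_X f_Y"
    and tau_X_defined: "\<And>t. 0 \<le> t \<Longrightarrow> 0 < distr_fun N Y t \<Longrightarrow> 0 < distr_fun M X t"
    and ratio_decreasing:
      "antimono_on (rev_hazard_ratio_dom M X f_X N Y f_Y)
         (\<lambda>t. ennreal (rev_hazard N Y f_Y t) / ennreal (rev_hazard M X f_X t))"
    and IPEX_X: "IPEX M X f_X"
  shows "IPEX N Y f_Y"
proof -
  let ?F = "distr_fun M X" and ?G = "distr_fun N Y"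
  let ?f = f_X and ?g = f_Y
  note f0 = nonneg_rv_density_nonneg[OF X] and g0 = nonneg_rv_density_nonneg[OF Y]
  have F_pos: "0 < t" if "0 < ?F t" for t
    using that nonneg_rv_density_distr_fun_nonpos[OF X, of t] by force
  have G_pos: "0 < t" if "0 < ?G t" for t
    using that nonneg_rv_density_distr_fun_nonpos[OF Y, of t] by force
  have GF: "0 < ?F t" if "0 < ?G t" for t
    using tau_X_defined[of t] G_pos[OF that] that by simp
  have F_mono: "?F u \<le> ?F v" and G_mono: "?G u \<le> ?G v" if "u \<le> v" for u v
    using primitive_mono[OF nonneg_rv_density_distr_fun[OF X] that]
      primitive_mono[OF nonneg_rv_density_distr_fun[OF Y] that] by (simp_all add: distr_fun_nonneg)
  have ratio: "(?g v * ?F v) * (?f u * ?G u) \<le> (?g u * ?F u) * (?f v * ?G v)"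
    if uv: "u \<le> v" and "0 < ?G u" for u v
  proof (cases "0 < ?f u \<and> 0 < ?g v")
    case True
    have pos: "0 < ?F u" "0 < ?F v" "0 < ?G u" "0 < ?G v" "0 < u" "0 < v"
      using that GF G_pos F_mono[OF uv] G_mono[OF uv] by (force intro: less_le_trans)+
    have in_dom: "u \<in> rev_hazard_ratio_dom M X ?f N Y ?g" "v \<in> rev_hazard_ratio_dom M X ?f N Y ?g"
      using pos True by (auto simp: rev_hazard_ratio_dom_def rev_hazard_def)
    have "ennreal (?g v / ?G v) / ennreal (?f v / ?F v) \<le> ennreal (?g u / ?G u) / ennreal (?f u / ?F u)"
      using ratio_decreasing in_dom uv by (auto simp: monotone_on_def rev_hazard_def)
    also have "\<dots> = ennreal ((?g u / ?G u) / (?f u / ?F u))"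
      using True pos g0 by (intro divide_ennreal) auto
    finally have le: "ennreal (?g v / ?G v) / ennreal (?f v / ?F v) \<le> ennreal ((?g u / ?G u) / (?f u / ?F u))" .
    \<comment> \<open>Otherwise the left-hand quotient would be infinite.\<close>
    then have "?f v \<noteq> 0" using True pos by (auto simp: ennreal_divide_zero top_unique)
    then have "0 < ?f v" using f0[of v] by simp
    then have "(?g v / ?G v) / (?f v / ?F v) \<le> (?g u / ?G u) / (?f u / ?F u)"
      using le True pos g0[of u] by (subst (asm) divide_ennreal) (auto simp: ennreal_le_iff)
    then show ?thesis using True pos \<open>0 < ?f v\<close> by (simp add: divide_simps mult_ac)
  next
    case False
    then have "?f u = 0 \<or> ?g v = 0" using f0[of u] g0[of v] by linarith
    then show ?thesis using f0 g0 by (auto simp: distr_fun_nonneg)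
  qed
  have f_mono: "(\<integral>\<^sup>+x\<in>{..v}. ennreal (?f x ^ 2) \<partial>lborel) * ennreal (?F u ^ 2)
      \<le> (\<integral>\<^sup>+x\<in>{..u}. ennreal (?f x ^ 2) \<partial>lborel) * ennreal (?F v ^ 2)"
    if "u \<le> v" "0 < ?F u" for u v
  proof -
    have "0 < ?F v" using F_mono[OF that(1)] that(2) by simp
    with that show ?thesis
      using IPEX_X F_pos past_extropy_le_iff[OF X] by (auto simp: IPEX_def mono_on_def)
  qed
  show ?thesis
    unfolding IPEX_def
  proof (rule mono_onI)
    fix s t assume "s \<in> {t. 0 < t \<and> 0 < ?G t}" "t \<in> {t. 0 < t \<and> 0 < ?G t}" "s \<le> t"
    then have s: "0 < ?G s" and t: "0 < ?G t" by auto
    show "past_extropy N Y ?g s \<le> past_extropy N Y ?g t"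
      unfolding past_extropy_le_iff[OF Y s t]
      by (rule normalised_square_integral_antimono[where f = ?f and F = ?F])
        (use X Y s \<open>s \<le> t\<close> GF ratio f_mono lr_ge_cross[OF lr f0 g0] in
          \<open>auto simp: nonneg_rv_density_nonneg nonneg_rv_density_measurable
             nonneg_rv_density_distr_fun distr_fun_nonneg\<close>)
  qed
qed

end
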